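(* For $B>0$, call a positive integer $m$ a bound admissible preproduct if $m=p_1p_2\cdots p_{k}$ is a product of $k\ge 2$ distinct primes $p_1<p_2<\cdots<p_k$, $m$ is cyclic (i.e. $\gcd(m,\phi(m))=1$, equivalently $p_i\nmid p_j-1$ for all $i,j$), and $m\,p_k<B$. Then, as $B\to\infty$, the number of bound admissible preproducts is at most \[ B\exp\!\left(\left(-\frac{1}{\sqrt{2}}+o(1)\right)\sqrt{\log B\,\log\log B}\right). \]
   Context: $\phi$ is Euler's totient function. Such an $m$ plays the role of $P_{d-1}=P_{d-2}p_{d-1}$ with $P_{d-2}p_{d-1}^2<B$ in the tabulation of Carmichael numbers below $B$. *)

theory Defs
  imports Complex_Main "HOL-Number_Theory.Totient" "HOL-Library.Landau_Symbols"
begin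

definition cyclic_number :: "nat \<Rightarrow> bool" where
  "cyclic_number m \<longleftrightarrow> gcd m (totient m) = 1"

text \<open>The list \<open>ps\<close> is the increasing enumeration \<open>p\<^sub>1 < \<dots> < p\<^sub>k\<close> of the prime factors of \<open>m\<close>,
  so \<open>last ps\<close> is \<open>p\<^sub>k\<close>.\<close>

definition bound_admissible_preproduct :: "real \<Rightarrow> nat \<Rightarrow> bool" where
  "bound_admissible_preproduct B m \<longleftrightarrow>
     (\<exists>ps :: nat list. length ps \<ge> 2 \<and> sorted_wrt (<) ps \<and> (\<forall>p\<in>set ps. prime p) \<and>
        m = prod_list ps \<and> cyclic_number m \<and> real m * real (last ps) < B)"

text \<open>Finiteness makes \<open>card\<close> the genuine count.\<close>

lemma finite_bound_admissible_preproducts: "finite {m. bound_admissible_preproduct B m}"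
proof (rule finite_subset)
  show "{m. bound_admissible_preproduct B m} \<subseteq> {..nat \<lceil>B\<rceil>}"
  proof clarify
    fix m assume "bound_admissible_preproduct B m"
    then obtain ps :: "nat list" where ps: "length ps \<ge> 2" "\<forall>p\<in>set ps. prime p"
        "real m * real (last ps) < B"
      unfolding bound_admissible_preproduct_def by blast
    have "last ps \<in> set ps" using ps(1) by (intro last_in_set) auto
    then have "last ps \<ge> 1" using ps(2) prime_ge_1_nat by blast
    then have "real m * 1 \<le> real m * real (last ps)" by (intro mult_left_mono) auto
    then have "real m \<le> B" using ps(3) by linarith
    then show "m \<le> nat \<lceil>B\<rceil>" by linarith
  qed
qed simp

end

theory Submission
  imports Defs "HOL-Real_Asymp.Real_Asymp"
begin

text \<open>
  Let \<open>L = sqrt (ln B * ln (ln B))\<close> and \<open>y = exp (L / sqrt 2)\<close>. Preproducts \<open>m\<close> whose largest prime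
  \<open>p\<close> exceeds \<open>y\<close> are multiples of \<open>p\<close> below \<open>B / p\<close>, so there are at most
  \<open>\<Sum>p>y. B / p\<^sup>2 = O(B / y)\<close> of them, and trivially at most \<open>B / y\<close> of them are \<open>\<le> B / y\<close>.
  The remaining ones are squarefree, \<open>y\<close>-smooth and larger than \<open>B / y\<close>, so they have at least
  \<open>v = ln B / ln y - 1\<close> prime factors. For every \<open>t \<ge> 1\<close> their number is at most
  \<open>\<Sum>m. (B / m) * t powr (\<omega> m - v) \<le> B * t powr (- v) * (\<Prod>p\<le>y. 1 + t / p)\<close>. Since
  \<open>\<Sum>p\<le>y. 1 / p = O(ln (ln y))\<close>, the choice \<open>t = sqrt (ln B) / (ln (ln B))\<^sup>2\<close>
  makes this \<open>B * exp (- (1 / sqrt 2 + o(1)) * L)\<close>, the same order as \<open>B / y\<close>.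
\<close>

section \<open>Upper bound for the sum of reciprocals of primes\<close>

lemma prod_primes_dvd:
  fixes n :: nat
  assumes "finite A" "\<And>p. p \<in> A \<Longrightarrow> prime p" "\<And>p. p \<in> A \<Longrightarrow> p dvd n"
  shows "\<Prod>A dvd n"
  using assms
proof (induction A rule: finite_induct)
  case (insert p A)
  have "coprime p (\<Prod>A)"
    using insert by (intro prod_coprime_right primes_coprime) auto
  with insert show ?case
    by (simp add: divides_mult)
qed simp

lemma prime_dvd_central_binomial:
  fixes p n :: nat
  assumes "prime p" "n < p" "p \<le> 2 * n"
  shows "p dvd (2 * n choose n)"
proof -
  have "fact n * fact n * (2 * n choose n) = (fact (2 * n) :: nat)"
    using binomial_fact_lemma[of n "2 * n"] by simp
  then have "p dvd fact n * fact n * (2 * n choose n)"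
    using assms by (simp add: prime_dvd_fact_iff)
  then show ?thesis
    using assms by (simp add: prime_dvd_mult_iff prime_dvd_fact_iff)
qed

text \<open>Chebyshev's argument: the product of these primes divides the central binomial
  coefficient \<open>2 * 2 ^ i choose 2 ^ i\<close>, which is at most
  \<open>2 ^ (2 * 2 ^ i)\<close>, while each prime contributes a factor above \<open>2 ^ i\<close>.
  Comparing exponents of 2 gives the bound.\<close>

lemma card_primes_dyadic:
  "i * card {p :: nat. prime p \<and> 2 ^ i < p \<and> p \<le> 2 ^ Suc i} \<le> 2 * 2 ^ i"
proof -
  let ?A = "{p :: nat. prime p \<and> 2 ^ i < p \<and> p \<le> 2 ^ Suc i}"
  have fin: "finite ?A" by (rule finite_subset[of _ "{..2 ^ Suc i}"]) auto
  have "(2 :: nat) ^ (i * card ?A) = (\<Prod>p\<in>?A. 2 ^ i)"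
    by (simp add: power_mult)
  also have "\<dots> \<le> \<Prod>?A"
    by (intro prod_mono) auto
  also have "\<dots> \<le> (2 * 2 ^ i choose 2 ^ i)"
  proof (rule dvd_imp_le)
    show "\<Prod>?A dvd (2 * 2 ^ i choose 2 ^ i)"
      by (intro prod_primes_dvd fin prime_dvd_central_binomial) auto
  qed simp
  also have "\<dots> \<le> 2 ^ (2 * 2 ^ i)"
    by (rule binomial_le_pow2)
  finally show ?thesis
    by (rule power_le_imp_le_exp[rotated]) simp
qed

lemma sum_inverse_primes_dyadic:
  assumes "i \<ge> 1"
  shows "(\<Sum>p | prime p \<and> 2 ^ i < p \<and> p \<le> 2 ^ Suc i. 1 / real p) \<le> 2 / real i"
proof -
  let ?A = "{p :: nat. prime p \<and> 2 ^ i < p \<and> p \<le> 2 ^ Suc i}"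
  have "(\<Sum>p\<in>?A. 1 / real p) \<le> (\<Sum>p\<in>?A. 1 / 2 ^ i)"
  proof (intro sum_mono)
    fix p assume "p \<in> ?A"
    then have "real (2 ^ i) \<le> real p" unfolding of_nat_le_iff by simp
    then show "1 / real p \<le> 1 / 2 ^ i" by (intro frac_le) simp_all
  qed
  also have "\<dots> = real (card ?A) / 2 ^ i" by simp
  also have "real (i * card ?A) \<le> real (2 * 2 ^ i)"
    unfolding of_nat_le_iff by (rule card_primes_dyadic)
  then have "real (card ?A) / 2 ^ i \<le> 2 / real i"
    using assms by (simp add: field_simps)
  finally show ?thesis .
qed

text \<open>The dyadic block added in the step from \<open>k\<close> to \<open>Suc k\<close>
  contributes at most \<open>2 / real (Suc k)\<close>, which the increment of
  \<open>2 * ln k\<close> absorbs. The constant \<open>5 / 2\<close> covers the base case, where the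
  sum is at most 1 + 1/2 + 1/3 + 1/4.\<close>

lemma sum_inverse_primes_le_pow2:
  assumes "k \<ge> 1"
  shows "(\<Sum>p | prime p \<and> p \<le> 2 ^ Suc k. 1 / real p) \<le> 5 / 2 + 2 * ln (real k)"
  using assms
proof (induction k rule: dec_induct)
  case base
  have "(\<Sum>p | prime p \<and> p \<le> 2 ^ Suc 1. 1 / real p) \<le> (\<Sum>p\<in>{1..4 :: nat}. 1 / real p)"
    by (intro sum_mono2) (auto dest: prime_ge_1_nat)
  also have "{1..4 :: nat} = {1, 2, 3, 4}" by auto
  finally show ?case by simp
next
  case (step k)
  let ?A = "{p :: nat. prime p \<and> p \<le> 2 ^ Suc k}"
  let ?B = "{p :: nat. prime p \<and> 2 ^ Suc k < p \<and> p \<le> 2 ^ Suc (Suc k)}"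
  have "{p :: nat. prime p \<and> p \<le> 2 ^ Suc (Suc k)} = ?A \<union> ?B"
    by auto
  moreover have "finite ?A" "finite ?B"
    by (auto intro: finite_subset[of _ "{..2 ^ Suc (Suc k)}"])
  ultimately have "(\<Sum>p | prime p \<and> p \<le> 2 ^ Suc (Suc k). 1 / real p)
      = (\<Sum>p\<in>?A. 1 / real p) + (\<Sum>p\<in>?B. 1 / real p)"
    by (simp only:) (intro sum.union_disjoint, auto)
  moreover have "(\<Sum>p\<in>?B. 1 / real p) \<le> 2 / real (Suc k)"
    by (rule sum_inverse_primes_dyadic) simp
  moreover have "1 / real (Suc k) \<le> ln (real (Suc k)) - ln (real k)"
  proof -
    have "ln (real k / real (Suc k)) \<le> real k / real (Suc k) - 1"
      using step by (intro ln_le_minus_one) auto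
    also have "\<dots> = - (1 / real (Suc k))" by (simp add: field_simps)
    finally show ?thesis using step by (simp add: ln_div)
  qed
  ultimately show ?case
    using step.IH by simp
qed

lemma sum_inverse_primes_le:
  fixes y :: real
  assumes "y > 1"
  shows "(\<Sum>p | prime p \<and> real p \<le> y. 1 / real p) \<le> 5 / 2 + 2 * ln (log 2 y + 1)"
proof -
  \<comment> \<open>Rounding up puts \<open>y\<close> below \<open>2 ^ Suc k\<close>, gives
    \<open>k \<ge> 1\<close> even for \<open>y\<close> close to 1, and costs at most 1, hence the
    \<open>+ 1\<close> in the bound.\<close>
  define k where "k = nat \<lceil>log 2 y\<rceil>"
  have pos: "log 2 y > 0" using assms by simp
  then have k: "k \<ge> 1" "real k \<le> log 2 y + 1" "log 2 y \<le> real (Suc k)"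
    unfolding k_def by linarith+
  have "y = 2 powr log 2 y" using assms by simp
  also have "\<dots> \<le> 2 powr real (Suc k)" using k by (intro powr_mono) auto
  also have "\<dots> = 2 ^ Suc k" by (rule powr_realpow) simp
  finally have y: "y \<le> real (2 ^ Suc k)" by simp
  have "(\<Sum>p | prime p \<and> real p \<le> y. 1 / real p)
      \<le> (\<Sum>p | prime p \<and> p \<le> 2 ^ Suc k. 1 / real p)"
  proof (intro sum_mono2)
    show "finite {p :: nat. prime p \<and> p \<le> 2 ^ Suc k}"
      by (auto intro: finite_subset[of _ "{..2 ^ Suc k}"])
    show "{p. prime p \<and> real p \<le> y} \<subseteq> {p. prime p \<and> p \<le> 2 ^ Suc k}"
      using y of_nat_le_iff[of _ "2 ^ Suc k", where 'a = real] by (auto simp del: power_Suc of_nat_power)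
  qed auto
  also have "\<dots> \<le> 5 / 2 + 2 * ln (real k)"
    using k by (intro sum_inverse_primes_le_pow2) auto
  also have "\<dots> \<le> 5 / 2 + 2 * ln (log 2 y + 1)"
    using k by simp
  finally show ?thesis .
qed

section \<open>Counting by number of prime factors and by large factors\<close>

lemma sum_inverse_squares_le:
  assumes "n \<ge> 1"
  shows "(\<Sum>k\<in>{n<..N}. 1 / real k ^ 2) \<le> 1 / real n"
proof -
  have "(\<Sum>k\<in>{n<..N}. 1 / real k ^ 2) \<le> 1 / real n - 1 / real N" if "N \<ge> n"
    using that
  proof (induction N rule: dec_induct)
    case (step N)
    have "{n<..Suc N} = insert (Suc N) {n<..N}" using step by auto
    \<comment> \<open>Comparison with \<open>1 / (N * Suc N)\<close> makes the sum
      telescope.\<close>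
    moreover have "1 / real (Suc N) ^ 2 \<le> 1 / real N - 1 / real (Suc N)"
    proof -
      have "1 / real (Suc N) ^ 2 \<le> 1 / (real N * real (Suc N))"
        using step(1) assms unfolding power2_eq_square
        by (intro divide_left_mono mult_right_mono) auto
      also have "\<dots> = 1 / real N - 1 / real (Suc N)"
        using step(1) assms by (simp add: field_simps)
      finally show ?thesis .
    qed
    ultimately show ?case using step by simp
  qed simp
  then show ?thesis
    by (cases "N \<ge> n") (auto intro: order_trans)
qed

text \<open>Weighting each set by \<open>t ^ card T\<close> is Rankin's trick applied to the number of prime factors.\<close>

lemma card_subsets_prod_le:
  fixes P :: "nat set" and t v B :: real
  assumes "finite P" "0 \<notin> P" "t \<ge> 1" "B \<ge> 0"
  shows "real (card {T. T \<subseteq> P \<and> v \<le> real (card T) \<and> real (\<Prod>T) \<le> B})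
      \<le> B * exp (t * (\<Sum>p\<in>P. 1 / real p) - v * ln t)"
proof -
  let ?C = "{T. T \<subseteq> P \<and> v \<le> real (card T) \<and> real (\<Prod>T) \<le> B}"
  have "real (card ?C) = (\<Sum>T\<in>?C. 1)" by simp
  also have "\<dots> \<le> (\<Sum>T\<in>?C. B * t powr (- v) * (\<Prod>p\<in>T. t / real p))"
  proof (intro sum_mono)
    fix T assume T: "T \<in> ?C"
    have fin: "finite T" and nz: "0 \<notin> T"
      using T assms finite_subset by auto
    have pos: "real (\<Prod>T) > 0"
      using fin nz by (metis of_nat_0_less_iff prod_pos gr0I)
    \<comment> \<open>Both factors are at least 1: the first by the size constraint on
      \<open>T\<close>, the second because \<open>t \<ge> 1\<close> and the exponent is
      nonnegative.\<close>
    have "1 * 1 \<le> (B / real (\<Prod>T)) * t powr (real (card T) - v)"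
      using T pos assms by (intro mult_mono ge_one_powr_ge_zero) auto
    also have "\<dots> = B * t powr (- v) * (t ^ card T / real (\<Prod>T))"
      using assms by (simp add: powr_diff powr_realpow powr_minus field_simps)
    also have "t ^ card T / real (\<Prod>T) = (\<Prod>p\<in>T. t / real p)"
      by (simp add: prod_dividef)
    finally show "1 \<le> B * t powr (- v) * (\<Prod>p\<in>T. t / real p)" by simp
  qed
  \<comment> \<open>Without the constraints on \<open>T\<close> the sum runs over all subsets of
    \<open>P\<close> and factors into a product over \<open>P\<close>.\<close>
  also have "\<dots> \<le> (\<Sum>T\<in>Pow P. B * t powr (- v) * (\<Prod>p\<in>T. t / real p))"
    using assms by (intro sum_mono2) (auto intro!: mult_nonneg_nonneg prod_nonneg)
  also have "\<dots> = B * t powr (- v) * (\<Prod>p\<in>P. t / real p + 1)"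
    using assms by (subst prod_add) (auto simp: sum_distrib_left)
  also have "\<dots> \<le> B * t powr (- v) * (\<Prod>p\<in>P. exp (t / real p))"
    using assms exp_ge_add_one_self
    by (intro mult_left_mono prod_mono) (auto simp: add.commute)
  also have "(\<Prod>p\<in>P. exp (t / real p)) = exp (t * (\<Sum>p\<in>P. 1 / real p))"
    using assms by (simp add: exp_sum[symmetric] sum_distrib_left)
  also have "B * t powr (- v) * exp (t * (\<Sum>p\<in>P. 1 / real p))
      = B * exp (t * (\<Sum>p\<in>P. 1 / real p) - v * ln t)"
    using assms by (simp add: powr_def exp_diff exp_minus field_simps)
  finally show ?thesis .
qed

text \<open>A product of \<open>card T\<close> primes up to \<open>y\<close> is at most
  \<open>y ^ card T\<close>, so exceeding \<open>B / y\<close> forces \<open>card T\<close> to be at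
  least \<open>ln B / ln y - 1\<close>. The weighted count of subsets then applies with this value
  as \<open>v\<close>.\<close>

lemma card_smooth_squarefree_le:
  fixes y t B :: real
  assumes "y > 1" "t \<ge> 1" "B > 0"
  shows "real (card {m. \<exists>T. (\<forall>p\<in>T. prime p \<and> real p \<le> y) \<and> m = \<Prod>T \<and> B / y < real m \<and> real m \<le> B})
      \<le> B * exp (t * (5 / 2 + 2 * ln (log 2 y + 1)) - (ln B / ln y - 1) * ln t)"
    (is "real (card ?M) \<le> _")
proof -
  define P where "P = {p :: nat. prime p \<and> real p \<le> y}"
  define v where "v = ln B / ln y - 1"
  let ?C = "{T. T \<subseteq> P \<and> v \<le> real (card T) \<and> real (\<Prod>T) \<le> B}"
  have finP: "finite P"
    unfolding P_def by (rule finite_subset[of _ "{..nat \<lceil>y\<rceil>}"]) (auto, linarith)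
  have zP: "0 \<notin> P" unfolding P_def by auto
  have "?M \<subseteq> Prod ` ?C"
  proof clarify
    fix T assume T: "\<forall>p\<in>T. prime p \<and> real p \<le> y" "B / y < real (\<Prod>T)" "real (\<Prod>T) \<le> B"
    have TP: "T \<subseteq> P" using T unfolding P_def by auto
    have "B / y < (\<Prod>p\<in>T. real p)" using T by simp
    also have "\<dots> \<le> (\<Prod>p\<in>T. y)" using T by (intro prod_mono) auto
    also have "\<dots> = y ^ card T" by simp
    finally have "ln (B / y) \<le> ln (y ^ card T)"
      using assms by simp
    then have "ln B - ln y \<le> real (card T) * ln y"
      using assms by (simp add: ln_div ln_realpow)
    then have "v \<le> real (card T)"
      using assms unfolding v_def by (simp add: field_simps)
    with TP T show "\<Prod>T \<in> Prod ` ?C" by blast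
  qed
  then have "card ?M \<le> card ?C"
    using finP by (intro surj_card_le) auto
  also have "real (card ?C) \<le> B * exp (t * (\<Sum>p\<in>P. 1 / real p) - v * ln t)"
    using assms finP zP by (intro card_subsets_prod_le) auto
  also have "\<dots> \<le> B * exp (t * (5 / 2 + 2 * ln (log 2 y + 1)) - v * ln t)"
    using assms sum_inverse_primes_le[of y] unfolding P_def
    by (intro mult_left_mono) auto
  finally show ?thesis unfolding v_def by simp
qed

text \<open>Writing \<open>m = p * q\<close>, the condition \<open>m * p \<le> B\<close> becomes
  \<open>q \<le> B / p ^ 2\<close>. It remains to count the pairs \<open>(p, q)\<close>, with
  \<open>p\<close> running over all integers above \<open>y\<close>.\<close>

lemma card_large_factor_le:
  fixes y B :: real
  assumes "y \<ge> 1" "B > 0"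
  shows "finite {m. \<exists>p>0. y < real p \<and> p dvd m \<and> m > 0 \<and> real m * real p \<le> B}" (is "finite ?M")
    and "real (card {m. \<exists>p>0. y < real p \<and> p dvd m \<and> m > 0 \<and> real m * real p \<le> B}) \<le> 2 * B / y"
proof -
  define n where "n = nat \<lfloor>y\<rfloor>"
  define N where "N = nat \<lfloor>B\<rfloor>"
  define D where "D = (SIGMA p:{n<..N}. {1..nat \<lfloor>B / real p ^ 2\<rfloor>})"
  \<comment> \<open>Since \<open>y \<ge> 1\<close>, rounding down at most halves it; this is the
    source of the factor 2 in \<open>2 * B / y\<close>.\<close>
  have n: "n \<ge> 1" "y \<le> 2 * real n" 
  proof -
    have "\<lfloor>y\<rfloor> \<ge> 1" using assms by simp
    then show "n \<ge> 1" unfolding n_def by linarith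
    have "real n = real_of_int \<lfloor>y\<rfloor>" using \<open>\<lfloor>y\<rfloor> \<ge> 1\<close> unfolding n_def by simp
    then show "y \<le> 2 * real n" using \<open>\<lfloor>y\<rfloor> \<ge> 1\<close> by linarith
  qed
  have sub: "?M \<subseteq> (\<lambda>(p, q). p * q) ` D"
  proof clarify
    fix m p :: nat
    assume *: "0 < p" "y < real p" "p dvd m" "m > 0" "real m * real p \<le> B"
    then obtain q where q: "m = p * q" by blast
    with * have q0: "q \<ge> 1" by (cases q) auto
    have "real q \<le> B / real p ^ 2"
      using * q by (simp add: field_simps power2_eq_square)
    then have 1: "q \<le> nat \<lfloor>B / real p ^ 2\<rfloor>" by linarith
    have "1 * real p \<le> real m * real p" using * by (intro mult_right_mono) auto
    then have "p \<le> N" using * unfolding N_def by linarith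
    moreover have "n < p" using * unfolding n_def by linarith
    ultimately have "(p, q) \<in> D" using 1 q0 unfolding D_def by auto
    then show "m \<in> (\<lambda>(p, q). p * q) ` D" using q by (intro image_eqI[of _ _ "(p, q)"]) auto
  qed
  have fin: "finite D" unfolding D_def by auto
  with sub show "finite ?M" by (rule finite_surj[rotated])
  have "card ?M \<le> card D" using fin sub by (intro surj_card_le)
  also have "real (card D) = (\<Sum>p\<in>{n<..N}. real (nat \<lfloor>B / real p ^ 2\<rfloor>))"
    unfolding D_def by simp
  also have "\<dots> \<le> (\<Sum>p\<in>{n<..N}. B * (1 / real p ^ 2))"
    using assms by (intro sum_mono) auto
  also have "\<dots> = B * (\<Sum>p\<in>{n<..N}. 1 / real p ^ 2)"
    by (simp add: sum_distrib_left)
  also have "\<dots> \<le> B * (1 / real n)"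
    using assms sum_inverse_squares_le[OF n(1), of N] by (intro mult_left_mono) auto
  also have "\<dots> \<le> 2 * B / y"
    using n assms by (simp add: field_simps)
  finally show "real (card ?M) \<le> 2 * B / y" by simp
qed

lemma card_bound_admissible_preproduct_le:
  fixes y t B :: real
  assumes "y > 1" "t \<ge> 1" "B > 0"
  shows "real (card {m. bound_admissible_preproduct B m})
      \<le> 3 * B / y + B * exp (t * (5 / 2 + 2 * ln (log 2 y + 1)) - (ln B / ln y - 1) * ln t)"
proof -
  define M1 where "M1 = {m. \<exists>p>0. y < real p \<and> p dvd m \<and> m > 0 \<and> real m * real p \<le> B}"
  define M2 where "M2 = {m :: nat. m > 0 \<and> real m \<le> B / y}"
  define M3 where "M3 = {m. \<exists>T. (\<forall>p\<in>T. prime p \<and> real p \<le> y) \<and> m = \<Prod>T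
      \<and> B / y < real m \<and> real m \<le> B}"
  have sub: "{m. bound_admissible_preproduct B m} \<subseteq> M1 \<union> M2 \<union> M3"
  proof clarify
    fix m assume "bound_admissible_preproduct B m" "m \<notin> M3" "m \<notin> M2"
    then obtain ps :: "nat list" where ps: "length ps \<ge> 2" "sorted_wrt (<) ps"
        "\<forall>p\<in>set ps. prime p" "m = prod_list ps" "real m * real (last ps) < B"
      unfolding bound_admissible_preproduct_def by blast
    have last: "last ps \<in> set ps" using ps(1) by (intro last_in_set) auto
    then have last_ge: "last ps \<ge> 1" using ps(3) prime_ge_1_nat by blast
    have m0: "m > 0"
    proof (rule gr0I)
      assume "m = 0"
      then have "0 \<in> set ps" using ps(4) by (simp add: prod_list_zero_iff)
      then show False using ps(3) by auto
    qed
    have "distinct ps" using ps(2) by (simp add: strict_sorted_iff)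
    then have mT: "m = \<Prod>(set ps)" using ps(4) by (simp add: prod.distinct_set_conv_list)
    have "real m * 1 \<le> real m * real (last ps)" using last_ge by (intro mult_left_mono) auto
    then have mB: "real m \<le> B" using ps(5) by linarith
    have "B / y < real m" using \<open>m \<notin> M2\<close> m0 unfolding M2_def by auto
    \<comment> \<open>As \<open>m\<close> has the size required in \<open>M3\<close>, only
      smoothness of \<open>set ps\<close> can fail.\<close>
    with \<open>m \<notin> M3\<close> mT mB ps(3) obtain p where p: "p \<in> set ps" "real p > y"
      unfolding M3_def by (auto simp: not_le)
    \<comment> \<open>The size bound involves \<open>last ps\<close>, so that prime rather than
      \<open>p\<close> serves as the witness for \<open>M1\<close>; it exceeds \<open>y\<close>
      because \<open>p\<close> does.\<close>
    have "p \<le> last ps"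
    proof -
      have "sorted ps" using ps(2) by (simp add: strict_sorted_iff)
      moreover obtain i where "i < length ps" "p = ps ! i" using p(1) by (metis in_set_conv_nth)
      ultimately show ?thesis
        using ps(1) by (subst last_conv_nth) (auto intro!: sorted_nth_mono)
    qed
    moreover have "last ps dvd m" using last mT by (simp add: dvd_prod_eqI)
    ultimately show "m \<in> M1"
      using p last_ge m0 ps(5) unfolding M1_def by (intro CollectI exI[of _ "last ps"]) auto
  qed
  have fin: "finite M1" "finite M2" "finite M3"
  proof -
    show "finite M1" unfolding M1_def using assms by (intro card_large_factor_le(1)) auto
    show "finite M2" unfolding M2_def
      by (rule finite_subset[of _ "{..nat \<lceil>B / y\<rceil>}"]) (auto, linarith)
    have "M3 \<subseteq> {..nat \<lceil>B\<rceil>}"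
    proof
      fix m assume "m \<in> M3"
      then have "real m \<le> B" unfolding M3_def by blast
      then have "m \<le> nat \<lceil>B\<rceil>" by linarith
      then show "m \<in> {..nat \<lceil>B\<rceil>}" by simp
    qed
    then show "finite M3" by (rule finite_subset) simp
  qed
  have "card {m. bound_admissible_preproduct B m} \<le> card (M1 \<union> M2 \<union> M3)"
    using sub fin by (intro card_mono) auto
  also have "\<dots> \<le> card M1 + card M2 + card M3"
    by (meson add_mono card_Un_le order.refl order_trans)
  finally have "real (card {m. bound_admissible_preproduct B m})
      \<le> real (card M1) + real (card M2) + real (card M3)" by linarith
  moreover have "real (card M1) \<le> 2 * B / y"
    unfolding M1_def using assms by (intro card_large_factor_le(2)) auto
  moreover have "real (card M2) \<le> B / y"
  proof -
    have "M2 \<subseteq> {1..nat \<lfloor>B / y\<rfloor>}" unfolding M2_def by (auto, linarith+)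
    then have "card M2 \<le> card {1..nat \<lfloor>B / y\<rfloor>}" by (intro card_mono) auto
    also have "real (card {1..nat \<lfloor>B / y\<rfloor>}) \<le> B / y" using assms by simp
    finally show ?thesis by simp
  qed
  moreover have "real (card M3)
      \<le> B * exp (t * (5 / 2 + 2 * ln (log 2 y + 1)) - (ln B / ln y - 1) * ln t)"
    unfolding M3_def using assms by (intro card_smooth_squarefree_le) auto
  moreover have "3 * B / y = 2 * B / y + B / y" by (simp add: add_divide_distrib[symmetric])
  ultimately show ?thesis by linarith
qed

section \<open>Choice of parameters and asymptotics\<close>

theorem theorem9:
  "\<exists>\<epsilon> :: real \<Rightarrow> real. \<epsilon> \<in> o[at_top](\<lambda>_. 1) \<and>
     (\<forall>\<^sub>F B in at_top.
        real (card {m. bound_admissible_preproduct B m})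
          \<le> B * exp ((- (1 / sqrt 2) + \<epsilon> B) * sqrt (ln B * ln (ln B))))"
proof -
  define L :: "real \<Rightarrow> real" where "L = (\<lambda>B. sqrt (ln B * ln (ln B)))"
  \<comment> \<open>The denominator makes \<open>t * ln (ln y)\<close> of smaller order than
    \<open>L\<close>, yet \<open>ln t\<close> stays asymptotic to
    \<open>ln (ln B) / 2\<close>.\<close>
  define t :: "real \<Rightarrow> real" where "t = (\<lambda>B. sqrt (ln B) / ln (ln B) ^ 2)"
  \<comment> \<open>For \<open>y = exp (L B / sqrt 2)\<close>, the smooth term is
    \<open>B * exp (R B - L B / sqrt 2)\<close>. Thus \<open>R\<close> measures its excess over
    \<open>B / y\<close>, and the goal is that \<open>R\<close> is of smaller order than
    \<open>L\<close>.\<close>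
  define R :: "real \<Rightarrow> real" where
    "R = (\<lambda>B. L B / sqrt 2 + t B * (5 / 2 + 2 * ln (L B / sqrt 2 / ln 2 + 1))
            - (ln B / (L B / sqrt 2) - 1) * ln (t B))"
  \<comment> \<open>The total is \<open>B / y\<close> times \<open>3 + exp (R B)\<close>, which is
    at most \<open>4 * exp \<bar>R B\<bar>\<close>; \<open>\<epsilon> B * L B\<close> is the
    logarithm of this last factor once \<open>L B > 0\<close>.\<close>
  define \<epsilon> where "\<epsilon> = (\<lambda>B. (ln 4 + \<bar>R B\<bar>) / L B)"
  have Lpos: "\<forall>\<^sub>F B in at_top. L B > 0"
    unfolding L_def by real_asymp
  have "((\<lambda>B. R B / L B) \<longlongrightarrow> 0) at_top"
  proof -
    have "((\<lambda>B. t B * (5 / 2 + 2 * ln (L B / sqrt 2 / ln 2 + 1)) / L B) \<longlongrightarrow> 0) at_top"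
      and "((\<lambda>B. ln B * ln (t B) / L B ^ 2) \<longlongrightarrow> 1 / 2) at_top"
      and "((\<lambda>B. ln (t B) / L B) \<longlongrightarrow> 0) at_top"
      unfolding L_def t_def by real_asymp+
    then have "((\<lambda>B. 1 / sqrt 2 + t B * (5 / 2 + 2 * ln (L B / sqrt 2 / ln 2 + 1)) / L B
        - sqrt 2 * (ln B * ln (t B) / L B ^ 2) + ln (t B) / L B)
        \<longlongrightarrow> 1 / sqrt 2 + 0 - sqrt 2 * (1 / 2) + 0) at_top"
      by (intro tendsto_add tendsto_diff tendsto_mult tendsto_const)
    \<comment> \<open>This cancellation fixes the constant: for \<open>y = exp (c * L)\<close> the
      two bounds save \<open>c * L\<close> and about \<open>L / (2 * c)\<close> in the exponent, and
      these agree exactly at \<open>c = 1 / sqrt 2\<close>.\<close>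
    also have "1 / sqrt 2 + 0 - sqrt 2 * (1 / 2) + 0 = (0 :: real)"
      by (simp add: field_simps)
    finally have "((\<lambda>B. 1 / sqrt 2 + t B * (5 / 2 + 2 * ln (L B / sqrt 2 / ln 2 + 1)) / L B
        - sqrt 2 * (ln B * ln (t B) / L B ^ 2) + ln (t B) / L B) \<longlongrightarrow> 0) at_top" .
    moreover have "\<forall>\<^sub>F B in at_top.
        1 / sqrt 2 + t B * (5 / 2 + 2 * ln (L B / sqrt 2 / ln 2 + 1)) / L B
        - sqrt 2 * (ln B * ln (t B) / L B ^ 2) + ln (t B) / L B = R B / L B"
      using Lpos by eventually_elim
        (simp add: R_def add_divide_distrib diff_divide_distrib left_diff_distrib power2_eq_square)
    ultimately show ?thesis
      by (rule Lim_transform_eventually)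
  qed
  then have "((\<lambda>B. \<bar>R B / L B\<bar>) \<longlongrightarrow> 0) at_top"
    by (rule tendsto_rabs_zero)
  moreover have "((\<lambda>B. ln 4 / L B) \<longlongrightarrow> 0) at_top"
    unfolding L_def by real_asymp
  ultimately have "((\<lambda>B. ln 4 / L B + \<bar>R B / L B\<bar>) \<longlongrightarrow> 0) at_top"
    using tendsto_add_zero by blast
  moreover from Lpos have "\<forall>\<^sub>F B in at_top. ln 4 / L B + \<bar>R B / L B\<bar> = \<epsilon> B"
    by eventually_elim (simp add: \<epsilon>_def add_divide_distrib)
  ultimately have "(\<epsilon> \<longlongrightarrow> 0) at_top"
    by (rule Lim_transform_eventually)
  then have "\<epsilon> \<in> o[at_top](\<lambda>_. 1)"
    by (intro smalloI_tendsto) auto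
  moreover have "\<forall>\<^sub>F B in at_top. t B \<ge> 1"
    unfolding t_def by real_asymp
  with Lpos eventually_gt_at_top[of 0]
  have "\<forall>\<^sub>F B in at_top. real (card {m. bound_admissible_preproduct B m})
      \<le> B * exp ((- (1 / sqrt 2) + \<epsilon> B) * L B)"
  proof eventually_elim
    case (elim B)
    define y where "y = exp (L B / sqrt 2)"
    have y: "y > 1" "ln y = L B / sqrt 2" "log 2 y = L B / sqrt 2 / ln 2"
      using elim by (simp_all add: y_def log_def)
    have "real (card {m. bound_admissible_preproduct B m})
        \<le> 3 * B / y + B * exp (t B * (5 / 2 + 2 * ln (log 2 y + 1)) - (ln B / ln y - 1) * ln (t B))"
      using y elim by (intro card_bound_admissible_preproduct_le) auto
    also have "t B * (5 / 2 + 2 * ln (log 2 y + 1)) - (ln B / ln y - 1) * ln (t B)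
        = R B - L B / sqrt 2"
      unfolding y R_def by simp
    also have "3 * B / y + B * exp (R B - L B / sqrt 2)
        = B * exp (- (L B / sqrt 2)) * (3 + exp (R B))"
    proof -
      have "exp (R B - L B / sqrt 2) = exp (- (L B / sqrt 2)) * exp (R B)"
        by (simp flip: exp_add)
      moreover have "3 * B / y = 3 * B * exp (- (L B / sqrt 2))"
        by (simp add: y_def exp_minus divide_inverse)
      ultimately show ?thesis by (simp add: algebra_simps)
    qed
    also have "\<dots> \<le> B * exp (- (L B / sqrt 2)) * (4 * exp \<bar>R B\<bar>)"
    proof -
      have "exp (R B) \<le> exp \<bar>R B\<bar>" "1 \<le> exp \<bar>R B\<bar>" by simp_all
      then have "3 + exp (R B) \<le> 4 * exp \<bar>R B\<bar>" by linarith
      then show ?thesis using elim by (intro mult_left_mono) auto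
    qed
    also have "\<dots> = B * exp ((- (1 / sqrt 2) + \<epsilon> B) * L B)"
    proof -
      have "(- (1 / sqrt 2) + \<epsilon> B) * L B = - (L B / sqrt 2) + (ln 4 + \<bar>R B\<bar>)"
        using elim by (simp add: \<epsilon>_def left_diff_distrib)
      then have "exp ((- (1 / sqrt 2) + \<epsilon> B) * L B)
          = exp (- (L B / sqrt 2)) * (4 * exp \<bar>R B\<bar>)"
        by (simp only: exp_add) simp
      then show ?thesis by simp
    qed
    finally show ?case .
  qed
  ultimately show ?thesis
    unfolding L_def by blast
qed

end
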